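(* For every integer $k\ge 0$, the degree distribution $x\mapsto P(k,x)$ of Haros graphs, as a real function of $x\in[0,1]$, is piece-wise linear and continuous with the exception of a set of measure zero: there is a set $N\subset[0,1]$ of Lebesgue measure zero such that the restriction of $P(k,\cdot)$ to $[0,1]\setminus N$ is continuous and piece-wise linear (i.e. $[0,1]$ can be divided into finitely many intervals such that, on the part of each interval outside $N$, $P(k,\cdot)$ coincides with an affine function of $x$).
   Context: Haros graphs: these are finite simple graphs whose nodes are linearly ordered, so that each has a first and a last node (the extreme nodes). The initial graph $G_0$ consists of two nodes joined by an edge, and $G_{0/1}=G_{1/1}=G_0$. The concatenation $G_L\oplus G_R$ is obtained from disjoint copies of $G_L$ and $G_R$ by identifying the last node of $G_L$ with the first node of $G_R$ (the degrees add), and then adding one new edge joining the first node of $G_L$ to the last node of $G_R$; the nodes of $G_L$ are ordered before those of $G_R$. Every reduced fraction $p/q\in(0,1)$ is uniquely the mediant $p/q=(a+c)/(b+d)$ of two reduced fractions $a/b<c/d$ in $[0,1]$ with $p=a+c$, $q=b+d$ and $bc-ad=1$ (its parents in the Farey binary tree, with starting fractions $0/1$ and $1/1$). One defines recursively $G_{p/q}=G_{a/b}\oplus G_{c/d}$. The graph $G_{p/q}$ has $q+1$ nodes. Degree distribution (boundary node convention): for a reduced rational $x=p/q\in[0,1]$, the first and last nodes of $G_{p/q}$ are identified as a single boundary node whose degree is defined to be the sum of the degrees of the two extreme nodes in $G_{p/q}$; the other nodes keep their degree. This gives $q$ nodes in total, and $P(k,p/q)$ is the number of these $q$ nodes having degree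 $k$, divided by $q$. For irrational $x\in[0,1]$ the Haros graph $G_x$ is infinite, obtained as the limit of the finite Haros graphs $G_{p_n/q_n}$, where $p_n/q_n$ are the continued fraction convergents of $x$, and $P(k,x)=\lim_{n\to\infty}P(k,p_n/q_n)$. *)

theory Defs
  imports "HOL-Analysis.Analysis"
begin

(* A finite simple graph with linearly ordered nodes is given in canonical labelling: the nodes
   are {0..final_node G} with their usual order, and an edge is a two-element set of nodes. *)
record ograph =
  final_node :: nat
  edges :: "nat set set"

definition node_degree :: "ograph \<Rightarrow> nat \<Rightarrow> nat" where
  "node_degree G v = card {e \<in> edges G. v \<in> e}"

definition initial_graph :: ograph where
  "initial_graph = \<lparr>final_node = 1, edges = {{0, 1}}\<rparr>"

(* The nodes of H are shifted so that its first node falls on the last node of G. *)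
definition graph_concat :: "ograph \<Rightarrow> ograph \<Rightarrow> ograph" (infixl "\<oplus>\<^sub>g" 65) where
  "G \<oplus>\<^sub>g H =
     \<lparr>final_node = final_node G + final_node H,
      edges = edges G \<union> (\<lambda>e. (\<lambda>v. final_node G + v) ` e) ` edges H
              \<union> {{0, final_node G + final_node H}}\<rparr>"

(* is_haros p q G: G is the Haros graph of the fraction p/q.  The fractions p/q reached are exactly
   the reduced ones in [0,1], and the condition b * c - a * d = 1 already forces a/b < c/d;
   see haros_graph_reduced and haros_graph_ex1 below. *)
inductive is_haros :: "nat \<Rightarrow> nat \<Rightarrow> ograph \<Rightarrow> bool" where
  zero: "is_haros 0 1 initial_graph"
| one: "is_haros 1 1 initial_graph"
| mediant: "is_haros (a + c) (b + d) (G\<^sub>L \<oplus>\<^sub>g G\<^sub>R)"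
    if "is_haros a b G\<^sub>L" "is_haros c d G\<^sub>R" "b * c = a * d + 1"

definition haros_graph :: "nat \<Rightarrow> nat \<Rightarrow> ograph" where
  "haros_graph p q = (THE G. is_haros p q G)"

(* The two extreme nodes are merged into one boundary node, here represented by node 0; the nodes
   after merging are {..<final_node G}. *)
definition merged_degree :: "ograph \<Rightarrow> nat \<Rightarrow> nat" where
  "merged_degree G v =
     (if v = 0 then node_degree G 0 + node_degree G (final_node G) else node_degree G v)"

definition frac_degree_dist :: "nat \<Rightarrow> nat \<Rightarrow> nat \<Rightarrow> real" where
  "frac_degree_dist k p q =
     real (card {v \<in> {..<final_node (haros_graph p q)}. merged_degree (haros_graph p q) v = k})
       / real q"

primrec complete_quotient :: "real \<Rightarrow> nat \<Rightarrow> real" where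
  "complete_quotient x 0 = x"
| "complete_quotient x (Suc n) = 1 / frac (complete_quotient x n)"

(* The partial quotients are taken in nat, which is adequate for x \<ge> 0. *)
definition partial_quotient :: "real \<Rightarrow> nat \<Rightarrow> nat" where
  "partial_quotient x n = nat \<lfloor>complete_quotient x n\<rfloor>"

fun convergent_num :: "real \<Rightarrow> nat \<Rightarrow> nat" where
  "convergent_num x 0 = partial_quotient x 0"
| "convergent_num x (Suc 0) = partial_quotient x 1 * partial_quotient x 0 + 1"
| "convergent_num x (Suc (Suc n)) =
     partial_quotient x (Suc (Suc n)) * convergent_num x (Suc n) + convergent_num x n"

fun convergent_den :: "real \<Rightarrow> nat \<Rightarrow> nat" where
  "convergent_den x 0 = 1"
| "convergent_den x (Suc 0) = partial_quotient x 1"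
| "convergent_den x (Suc (Suc n)) =
     partial_quotient x (Suc (Suc n)) * convergent_den x (Suc n) + convergent_den x n"

(* Meaningful for x in [0,1]; degree_dist_rational below treats the rational case. *)
definition degree_dist :: "nat \<Rightarrow> real \<Rightarrow> real" where
  "degree_dist k x =
     (if x \<in> \<rat>
      then THE y. \<exists>p q. coprime p q \<and> 0 < q \<and> x = real p / real q \<and> y = frac_degree_dist k p q
      else lim (\<lambda>n. frac_degree_dist k (convergent_num x n) (convergent_den x n)))"

subsection \<open>Well-definedness\<close>

lemma bezout_imp_coprime:
  fixes x y z w :: nat
  assumes "x * y = z * w + 1"
  shows "coprime y w"
proof (rule coprimeI)
  fix e assume "e dvd y" "e dvd w"
  then have "e dvd z * w + 1" "e dvd z * w"
    using assms[symmetric] by simp_all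
  then show "is_unit e"
    using dvd_add_right_iff by blast
qed

lemma haros_graph_reduced:
  assumes "is_haros p q G"
  shows "coprime p q" "0 < q" "p \<le> q"
proof -
  have "coprime p q \<and> 0 < q \<and> p \<le> q"
    using assms
  proof induction
    case (mediant a b GL c d GR)
    have "coprime (a + c) (b + d)"
      by (rule bezout_imp_coprime[of b _ a]) (use mediant.hyps in \<open>simp add: algebra_simps\<close>)
    then show ?case using mediant.IH by simp
  qed auto
  then show "coprime p q" "0 < q" "p \<le> q" by auto
qed

lemma final_node_haros: "is_haros p q G \<Longrightarrow> final_node G = q"
  by (induction rule: is_haros.induct) (auto simp: initial_graph_def graph_concat_def)

lemma edges_haros:
  "is_haros p q G \<Longrightarrow> e \<in> edges G \<Longrightarrow> \<exists>u v. u < v \<and> v \<le> final_node G \<and> e = {u, v}"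
proof (induction arbitrary: e rule: is_haros.induct)
  case (mediant a b GL c d GR)
  have pos: "0 < final_node GL + final_node GR"
    using final_node_haros haros_graph_reduced(2) mediant.hyps by fastforce
  from mediant.prems consider "e \<in> edges GL"
    | f where "f \<in> edges GR" "e = (\<lambda>v. final_node GL + v) ` f"
    | "e = {0, final_node GL + final_node GR}"
    by (auto simp: graph_concat_def)
  then show ?case
  proof cases
    case 1
    with mediant.IH(1) obtain u v where "u < v" "v \<le> final_node GL" "e = {u, v}" by blast
    then show ?thesis by (intro exI[of _ u] exI[of _ v]) (auto simp: graph_concat_def)
  next
    case 2
    with mediant.IH(2) obtain u v where "u < v" "v \<le> final_node GR" "f = {u, v}" by blast
    with 2 show ?thesis
      by (intro exI[of _ "final_node GL + u"] exI[of _ "final_node GL + v"])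
         (auto simp: graph_concat_def)
  next
    case 3
    with pos show ?thesis
      by (intro exI[of _ 0] exI[of _ "final_node GL + final_node GR"])
         (auto simp: graph_concat_def)
  qed
qed (auto simp: initial_graph_def)

lemma parents_unique:
  fixes a b c d a' b' c' d' :: nat
  assumes "b * c = a * d + 1" "b' * c' = a' * d' + 1"
    and "a + c = a' + c'" "b + d = b' + d'" and "0 < b" "0 < d" "0 < b'" "0 < d'"
  shows "a = a' \<and> b = b' \<and> c = c' \<and> d = d'"
proof -
  define p q where "p = int (a + c)" and "q = int (b + d)"
  have 1: "b * (a + c) = a * (b + d) + 1"
    using assms(1) by (simp add: algebra_simps)
  have 2: "b' * (a + c) = a' * (b + d) + 1"
    using assms(2) unfolding assms(3,4) by (simp add: algebra_simps)
  have cop: "coprime q p"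
    using bezout_imp_coprime[OF 1] unfolding p_def q_def
    by (simp only: coprime_int_iff coprime_commute)
  have "int b * p = int a * q + 1" "int b' * p = int a' * q + 1"
    using 1[THEN arg_cong[where f = int]] 2[THEN arg_cong[where f = int]] unfolding p_def q_def of_nat_add of_nat_mult of_nat_1
    by blast+
  then have eq: "(int b - int b') * p = (int a - int a') * q"
    by (simp add: left_diff_distrib)
  then have "q dvd (int b - int b') * p" by simp
  with cop have "q dvd int b - int b'"
    by (simp only: coprime_dvd_mult_left_iff)
  moreover have "\<bar>int b - int b'\<bar> < q" "q > 0"
    using assms(4-8) by (auto simp: q_def)
  ultimately have b: "b = b'"
    using zdvd_imp_le[of q "\<bar>int b - int b'\<bar>"] by force
  with eq \<open>q > 0\<close> have "a = a'" by simp
  with b assms(3,4) show ?thesis by simp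
qed

lemma is_haros_unique: "is_haros p q G \<Longrightarrow> is_haros p q H \<Longrightarrow> G = H"
proof (induction arbitrary: H rule: is_haros.induct)
  case zero
  then show ?case
    by (cases rule: is_haros.cases) (auto dest: haros_graph_reduced)
next
  case one
  then show ?case
  proof (cases rule: is_haros.cases)
    case (mediant a b GL c d GR)
    then have "0 < b" "0 < d" by (auto dest: haros_graph_reduced)
    moreover have "1 = b + d" using mediant by simp
    ultimately have False by linarith
    then show ?thesis ..
  qed auto
next
  case (mediant a b GL c d GR)
  have pos: "0 < b" "0 < d"
    using mediant.hyps haros_graph_reduced by blast+
  from mediant.prems show ?case
  proof (cases rule: is_haros.cases)
    case (mediant a' b' GL' c' d' GR')
    have "0 < b'" "0 < d'"
      using mediant haros_graph_reduced by blast+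
    then have "a = a' \<and> b = b' \<and> c = c' \<and> d = d'"
      using parents_unique[of b c a d b' c' a' d'] mediant mediant.hyps pos
        \<open>b * c = a * d + 1\<close> by auto
    then show ?thesis using mediant mediant.IH by metis
  qed (use pos in auto)
qed

lemma is_haros_exists:
  assumes "coprime p q" "0 < q" "p \<le> q"
  shows "\<exists>G. is_haros p q G"
  using assms
proof (induction q arbitrary: p rule: less_induct)
  case (less q)
  show ?case
  proof (cases "q = 1")
    case True
    with less.prems have "p = 0 \<or> p = 1" by auto
    with True show ?thesis using is_haros.zero is_haros.one by auto
  next
    case False
    with less.prems have q: "q \<ge> 2" by simp
    have p: "p < q" "0 < p"
      using less.prems q by (cases "p = q"; cases "p = 0"; simp)+
    obtain x y where "p * x = q * y + 1"
      using bezout_nat[of p q] p less.prems(1) by auto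
    then have x: "(p * x) mod q = 1"
      using q by (simp only: mod_mult_self4 add.commute[of _ 1] mod_mult_self2) simp
    define b where "b = x mod q"
    define a where "a = b * p div q"
    have "(b * p) mod q = 1"
      using x by (simp add: b_def mod_mult_right_eq mult.commute)
    then have bp: "b * p = a * q + 1"
      unfolding a_def by (metis div_mult_mod_eq)
    have b: "0 < b" "b < q"
      using bp q by (auto simp: b_def intro!: gr0I)
    have "a * q < b * q"
      using bp mult_le_mono2[of p q b] p by linarith
    then have ab: "a < b" by simp
    have "a * q < p * q"
      using bp mult_le_mono1[of b q p] b by (simp only: mult.commute[of p q]) linarith
    then have ap: "a < p" by simp
    define c d where "c = p - a" and "d = q - b"
    have cd: "p = a + c" "q = b + d" "0 < d"
      using ap b by (auto simp: c_def d_def)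
    have bc: "b * c = a * d + 1"
      using bp unfolding cd by (simp add: algebra_simps)
    have "c \<le> d"
    proof (rule ccontr)
      assume "\<not> c \<le> d"
      then have "b * (d + 1) \<le> a * d + 1" 
        using bc mult_le_mono2[of "d + 1" c b] by simp
      moreover have "(a + 1) * d \<le> b * d" using ab by (intro mult_le_mono1) simp
      ultimately have "b + d \<le> 1" by (simp add: algebra_simps)
      then show False using b cd by simp
    qed
    have "coprime a b"
      using bezout_imp_coprime[of c b d a] bc by (simp add: mult.commute coprime_commute)
    then obtain GL where "is_haros a b GL" using less.IH b ab by (meson less_imp_le)
    moreover have "coprime c d"
      using bezout_imp_coprime[OF bc] .
    then obtain GR where "is_haros c d GR"
      using less.IH[of d c] \<open>c \<le> d\<close> cd b by auto
    ultimately show ?thesis using is_haros.mediant bc cd(1,2) by blast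
  qed
qed

theorem haros_graph_ex1:
  assumes "coprime p q" "0 < q" "p \<le> q"
  shows "\<exists>!G. is_haros p q G"
  using is_haros_exists[OF assms] is_haros_unique by blast

lemma haros_graph_eqI: "is_haros p q G \<Longrightarrow> haros_graph p q = G"
  unfolding haros_graph_def using is_haros_unique by blast

lemma is_haros_haros_graph:
  "coprime p q \<Longrightarrow> 0 < q \<Longrightarrow> p \<le> q \<Longrightarrow> is_haros p q (haros_graph p q)"
  using is_haros_exists haros_graph_eqI by blast

lemma degree_dist_rational:
  assumes "coprime p q" "0 < q"
  shows "degree_dist k (real p / real q) = frac_degree_dist k p q"
proof -
  have uniq: "p' = p \<and> q' = q"
    if "coprime p' q'" "0 < q'" "real p / real q = real p' / real q'" for p' q'
  proof -
    have "real (p * q') = real (p' * q)"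
      using that assms by (simp add: field_simps)
    then have eq: "p * q' = p' * q" by (simp only: of_nat_eq_iff)
    then have "q dvd q'" "q' dvd q"
      using assms that
      by (metis coprime_commute coprime_dvd_mult_right_iff dvd_triv_right)+
    then have "q = q'" by (rule dvd_antisym)
    with eq that show ?thesis by simp
  qed
  have "real p / real q \<in> \<rat>" by simp
  then show ?thesis
    unfolding degree_dist_def using uniq assms
    by auto
qed

end

theory Submission
  imports Defs
begin

text \<open>
  Off the rationals, the degree distribution is affine on each of finitely many intervals with
  rational endpoints.  Since an irrational number is never such an endpoint, it lies in the
  interior of its interval, and continuity on the irrationals follows.  So the exceptional set
  is the set of rationals in the unit interval.

  In a concatenation the two extreme nodes gain one edge each, the two nodes glued at the seam add
  their degrees, and all the others keep theirs.  Let \<open>t\<close> be the sum of the two extreme degrees (the degree of the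
  boundary node) and let \<open>N\<close> count the nodes of degree \<open>k\<close> other than the extreme ones.  Then \<open>N\<close> is
  additive at a mediant, except for one extra node when the seam node has degree \<open>k\<close>.

  The seam degrees are controlled by distinguishing, in a pair of neighbouring fractions, a pivot
  \<open>P\<close> from the other fraction \<open>O\<close>, in such a way that the extreme degree of \<open>O\<close> on the side of \<open>P\<close> is
  larger by one than that of \<open>P\<close> on its own outer side.  This holds whenever \<open>P\<close> is a parent of \<open>O\<close>.
  For such a pair with mediant \<open>M\<close>, the
  seam node has degree \<open>t(P) + 1\<close>, while \<open>t(M) = t(O) + 1\<close>, and both halves are again pivoted, as
  \<open>(P, M)\<close> and \<open>(O, M)\<close> (\<open>pivoted_mediant\<close>).  A descent in the Farey tree that keeps its pivot thus
  keeps its seam degree, and one that turns gets a larger one.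

  If \<open>k \<le> t(O)\<close>, seams of degree \<open>k\<close> appear below \<open>(P, O)\<close> only as long as the pivot \<open>P\<close> is kept, and
  this makes \<open>N\<close> the restriction of a linear form in the numerator and the denominator to all the
  fractions strictly between \<open>P\<close> and \<open>O\<close> (\<open>inner_count_linear\<close>).  Dividing by the denominator and
  going to the limit along the convergents gives an affine function of \<open>x\<close>
  (\<open>degree_dist_affine\<close>).  If \<open>k > t(O)\<close>, the interval is split at \<open>M\<close>; this raises \<open>t\<close> of the
  second fraction by one in both halves, so the splitting ends after finitely many rounds
  (\<open>piecewise_affine_pivoted\<close>).
\<close>

section \<open>Degrees under concatenation\<close>

definition edges_are_pairs :: "ograph \<Rightarrow> bool" where
  "edges_are_pairs G \<longleftrightarrow> (\<forall>e\<in>edges G. \<exists>u v. u < v \<and> v \<le> final_node G \<and> e = {u, v})"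

lemma finite_edges:
  assumes "edges_are_pairs G"
  shows "finite (edges G)"
proof (rule finite_subset)
  show "edges G \<subseteq> Pow {..final_node G}"
    using assms by (fastforce simp: edges_are_pairs_def)
qed simp

text \<open>
  The edges at a node come from three pairwise disjoint sources, so their numbers add up; at the
  seam the first two both contribute.
\<close>

lemma node_degree_concat:
  assumes G: "edges_are_pairs G" "0 < final_node G"
    and H: "edges_are_pairs H" "0 < final_node H"
  shows "node_degree (G \<oplus>\<^sub>g H) v =
    (if v \<le> final_node G then node_degree G v else 0) +
    (if final_node G \<le> v then node_degree H (v - final_node G) else 0) +
    of_bool (v = 0 \<or> v = final_node G + final_node H)"
proof -
  let ?m = "final_node G" and ?n = "final_node H"
  let ?sh = "\<lambda>e. (\<lambda>v. ?m + v) ` e"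
  define A where "A = {e \<in> edges G. v \<in> e}"
  define B where "B = {e \<in> ?sh ` edges H. v \<in> e}"
  define C where "C = {e \<in> {{0, ?m + ?n}}. v \<in> e}"
  have fin: "finite A" "finite B" "finite C"
    using finite_edges[OF G(1)] finite_edges[OF H(1)] by (auto simp: A_def B_def C_def)
  have inG: "\<exists>x y. x < y \<and> y \<le> ?m \<and> e = {x, y}" if "e \<in> edges G" for e
    using G(1) that by (auto simp: edges_are_pairs_def)
  have inH: "\<exists>x y. ?m \<le> x \<and> x < y \<and> y \<le> ?m + ?n \<and> e = {x, y}" if e: "e \<in> ?sh ` edges H" for e
  proof -
    obtain f where f: "f \<in> edges H" "e = ?sh f" using e by blast
    then obtain x y where "x < y" "y \<le> ?n" "f = {x, y}"
      using H(1) by (auto simp: edges_are_pairs_def)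
    with f show ?thesis by (intro exI[of _ "?m + x"] exI[of _ "?m + y"]) auto
  qed
  \<comment> \<open>An edge of the first part has a node below the seam, a shifted one has a node above it.\<close>
  have "A \<inter> B = {}"
  proof (rule ccontr)
    assume "A \<inter> B \<noteq> {}"
    then obtain e where "e \<in> edges G" "e \<in> ?sh ` edges H" by (auto simp: A_def B_def)
    then obtain x y x' y' where "x < y" "y \<le> ?m" "e = {x, y}" "?m \<le> x'" "x' < y'" "e = {x', y'}"
      using inG inH by meson
    then show False by (auto simp: doubleton_eq_iff)
  qed
  moreover have "(A \<union> B) \<inter> C = {}"
  proof (rule ccontr)
    assume "(A \<union> B) \<inter> C \<noteq> {}"
    then consider "{0, ?m + ?n} \<in> edges G" | "{0, ?m + ?n} \<in> ?sh ` edges H"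
      by (auto simp: A_def B_def C_def)
    then show False
    proof cases
      case 1
      then show False using inG[OF 1] H(2) by (auto simp: doubleton_eq_iff)
    next
      case 2
      then show False using inH[OF 2] G(2) by (auto simp: doubleton_eq_iff)
    qed
  qed
  moreover have "{e \<in> edges (G \<oplus>\<^sub>g H). v \<in> e} = (A \<union> B) \<union> C"
    by (auto simp: graph_concat_def A_def B_def C_def)
  ultimately have "node_degree (G \<oplus>\<^sub>g H) v = card A + card B + card C"
    using fin by (simp add: node_degree_def card_Un_disjoint)
  moreover have "card A = (if v \<le> ?m then node_degree G v else 0)"
  proof (cases "v \<le> ?m")
    case False
    then have "A = {}" using inG by (fastforce simp: A_def)
    with False show ?thesis by simp
  qed (simp add: A_def node_degree_def)
  moreover have "card B = (if ?m \<le> v then node_degree H (v - ?m) else 0)"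
  proof (cases "?m \<le> v")
    case True
    have "B = ?sh ` {e \<in> edges H. v - ?m \<in> e}"
      using True by (force simp: B_def)
    moreover have "inj ?sh" by (auto simp: inj_def inj_image_eq_iff)
    ultimately show ?thesis
      using True by (simp add: node_degree_def card_image inj_on_subset)
  next
    case False
    then have "B = {}" using inH by (fastforce simp: B_def)
    with False show ?thesis by simp
  qed
  moreover have "card C = of_bool (v = 0 \<or> v = ?m + ?n)"
  proof -
    have "C = (if v = 0 \<or> v = ?m + ?n then {{0, ?m + ?n}} else {})"
      by (auto simp: C_def)
    then show ?thesis by simp
  qed
  ultimately show ?thesis by simp
qed

section \<open>Counting nodes along the Farey tree\<close>

definition farey_neighbours :: "nat \<Rightarrow> nat \<Rightarrow> nat \<Rightarrow> nat \<Rightarrow> bool" where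
  "farey_neighbours a b c d \<longleftrightarrow> b * c = a * d + 1 \<and> 0 < b \<and> 0 < d \<and> c \<le> d"

definition first_degree :: "nat \<Rightarrow> nat \<Rightarrow> nat" where
  "first_degree p q = node_degree (haros_graph p q) 0"

definition last_degree :: "nat \<Rightarrow> nat \<Rightarrow> nat" where
  "last_degree p q = node_degree (haros_graph p q) q"

definition boundary_degree :: "nat \<Rightarrow> nat \<Rightarrow> nat" where
  "boundary_degree p q = first_degree p q + last_degree p q"

text \<open>
  The extreme nodes are left out because they are the only ones whose degree still changes in
  later concatenations.
\<close>

definition inner_count :: "nat \<Rightarrow> nat \<Rightarrow> nat \<Rightarrow> nat" where
  "inner_count k p q = card {v \<in> {0<..<q}. node_degree (haros_graph p q) v = k}"

text \<open>
  Neighbouring fractions are exactly those that may be concatenated; the determinant condition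
  also makes both of them reduced.
\<close>

lemma farey_neighbours_haros:
  assumes "farey_neighbours a b c d"
  shows "is_haros a b (haros_graph a b)" "is_haros c d (haros_graph c d)"
    and "is_haros (a + c) (b + d) (haros_graph (a + c) (b + d))"
    and "haros_graph (a + c) (b + d) = haros_graph a b \<oplus>\<^sub>g haros_graph c d"
proof -
  have n: "b * c = a * d + 1" "0 < b" "0 < d" "c \<le> d"
    using assms by (auto simp: farey_neighbours_def)
  have "a * d < b * d"
    using n(1) mult_le_mono2[OF n(4), of b] by linarith
  then have "a \<le> b" by simp
  moreover have "coprime a b"
    using bezout_imp_coprime[of c b d a] n(1) by (simp add: mult.commute coprime_commute)
  ultimately show 1: "is_haros a b (haros_graph a b)"
    using is_haros_haros_graph n by blast
  show 2: "is_haros c d (haros_graph c d)"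
    using is_haros_haros_graph n bezout_imp_coprime[OF n(1)] by blast
  have 3: "is_haros (a + c) (b + d) (haros_graph a b \<oplus>\<^sub>g haros_graph c d)"
    using is_haros.mediant[OF 1 2 n(1)] .
  then show 4: "haros_graph (a + c) (b + d) = haros_graph a b \<oplus>\<^sub>g haros_graph c d"
    by (rule haros_graph_eqI)
  show "is_haros (a + c) (b + d) (haros_graph (a + c) (b + d))"
    using 3 4 by simp
qed

lemma edges_are_pairs_haros: "is_haros p q G \<Longrightarrow> edges_are_pairs G"
  using edges_haros unfolding edges_are_pairs_def by blast

lemma node_degree_mediant:
  assumes n: "farey_neighbours a b c d"
  shows "node_degree (haros_graph (a + c) (b + d)) v =
    (if v \<le> b then node_degree (haros_graph a b) v else 0) +
    (if b \<le> v then node_degree (haros_graph c d) (v - b) else 0) +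
    of_bool (v = 0 \<or> v = b + d)"
proof -
  note h = farey_neighbours_haros[OF n]
  have fn: "final_node (haros_graph a b) = b" "final_node (haros_graph c d) = d"
    using final_node_haros h by blast+
  have "0 < b" "0 < d" using n by (auto simp: farey_neighbours_def)
  then show ?thesis
    using node_degree_concat[OF edges_are_pairs_haros[OF h(1)] _ edges_are_pairs_haros[OF h(2)]]
    by (simp add: h(4) fn)
qed

lemma first_degree_mediant:
  "farey_neighbours a b c d \<Longrightarrow> first_degree (a + c) (b + d) = first_degree a b + 1"
  by (auto simp: first_degree_def node_degree_mediant farey_neighbours_def)

lemma last_degree_mediant:
  "farey_neighbours a b c d \<Longrightarrow> last_degree (a + c) (b + d) = last_degree c d + 1"
  by (auto simp: last_degree_def node_degree_mediant farey_neighbours_def)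

text \<open>
  The inner nodes of the mediant are the inner nodes of the two parts and the seam, where the last
  node of the left part meets the first node of the right part.
\<close>

lemma inner_count_mediant:
  assumes n: "farey_neighbours a b c d"
  shows "inner_count k (a + c) (b + d) =
    inner_count k a b + inner_count k c d + of_bool (last_degree a b + first_degree c d = k)"
proof -
  have pos: "0 < b" "0 < d" using n by (auto simp: farey_neighbours_def)
  let ?deg = "node_degree (haros_graph (a + c) (b + d))"
  let ?L = "{v \<in> {0<..<b}. node_degree (haros_graph a b) v = k}"
  let ?R = "{v \<in> {0<..<d}. node_degree (haros_graph c d) v = k}"
  let ?M = "if ?deg b = k then {b} else {}"
  have "{v \<in> {0<..<b + d}. ?deg v = k} = (?L \<union> (\<lambda>v. b + v) ` ?R) \<union> ?M" (is "?S = _")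
  proof (intro set_eqI)
    fix v
    consider "v = 0" | "0 < v" "v < b" | "v = b" | w where "v = b + w" "0 < w" "w < d" | "b + d \<le> v"
      by (metis add.right_neutral gr0I le_add_diff_inverse less_or_eq_imp_le linorder_neqE_nat
          linorder_not_le nat_add_left_cancel_less)
    then show "v \<in> ?S \<longleftrightarrow> v \<in> (?L \<union> (\<lambda>v. b + v) ` ?R) \<union> ?M"
      using pos by cases (auto simp: node_degree_mediant[OF n])
  qed
  moreover have "card ((?L \<union> (\<lambda>v. b + v) ` ?R) \<union> ?M) = card (?L \<union> (\<lambda>v. b + v) ` ?R) + card ?M"
    by (rule card_Un_disjoint) auto
  moreover have "card (?L \<union> (\<lambda>v. b + v) ` ?R) = card ?L + card ((\<lambda>v. b + v) ` ?R)"
    by (rule card_Un_disjoint) auto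
  moreover have "card ((\<lambda>v. b + v) ` ?R) = card ?R"
    by (rule card_image) simp
  moreover have "?deg b = last_degree a b + first_degree c d"
    using pos by (simp add: node_degree_mediant[OF n] last_degree_def first_degree_def)
  ultimately show ?thesis by (simp add: inner_count_def)
qed

text \<open>
  The boundary node changes the fraction by at most \<open>1 / q\<close>, which vanishes in the limit.
\<close>

lemma frac_degree_dist_eq:
  assumes "coprime p q" "0 < q" "p \<le> q"
  shows "frac_degree_dist k p q =
    (real (inner_count k p q) + of_bool (boundary_degree p q = k)) / real q"
proof -
  let ?G = "haros_graph p q"
  have fn: "final_node ?G = q"
    using final_node_haros is_haros_haros_graph[OF assms] by blast
  have "{v \<in> {..<q}. merged_degree ?G v = k} =
      {v \<in> {0<..<q}. node_degree ?G v = k} \<union> (if boundary_degree p q = k then {0} else {})"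
    using assms(2)
    by (auto simp: merged_degree_def fn boundary_degree_def first_degree_def last_degree_def)
  then have "card {v \<in> {..<q}. merged_degree ?G v = k} =
      inner_count k p q + of_bool (boundary_degree p q = k)"
    by (simp add: inner_count_def)
  then show ?thesis by (simp add: frac_degree_dist_def fn)
qed

section \<open>Pivots\<close>

text \<open>
  The pivot \<open>p / q\<close> may lie on either side of \<open>r / s\<close>.  The degree condition expresses what being a
  parent of \<open>r / s\<close> entails: the extreme node that \<open>r / s\<close> inherits from the pivot has got one more
  edge.
\<close>

definition pivoted :: "nat \<Rightarrow> nat \<Rightarrow> nat \<Rightarrow> nat \<Rightarrow> bool" where
  "pivoted p q r s \<longleftrightarrow>
     farey_neighbours p q r s \<and> first_degree r s = first_degree p q + 1 \<or>
     farey_neighbours r s p q \<and> last_degree r s = last_degree p q + 1"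

lemma farey_neighbours_mediant:
  assumes "farey_neighbours a b c d"
  shows "farey_neighbours a b (a + c) (b + d)" "farey_neighbours (a + c) (b + d) c d"
proof -
  have "a \<le> b"
    using farey_neighbours_haros(1)[OF assms] by (rule haros_graph_reduced)
  then show "farey_neighbours a b (a + c) (b + d)" "farey_neighbours (a + c) (b + d) c d"
    using assms by (auto simp: farey_neighbours_def algebra_simps)
qed

text \<open>
  With the pivot on the left, the seam has degree \<open>last_degree p q + first_degree r s\<close>, and the degree condition
  turns this into \<open>boundary_degree p q + 1\<close>.  The mediant has the extreme degrees
  \<open>first_degree p q + 1 = first_degree r s\<close> and \<open>last_degree r s + 1\<close>, whose sum is
  \<open>boundary_degree r s + 1\<close>, and it satisfies the degree condition towards each
  parent.  The other orientation is the mirror image.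
\<close>

lemma pivoted_mediant:
  assumes "pivoted p q r s"
  shows "pivoted p q (p + r) (q + s)" "pivoted r s (p + r) (q + s)"
    and "boundary_degree (p + r) (q + s) = boundary_degree r s + 1"
    and "inner_count k (p + r) (q + s) =
           inner_count k p q + inner_count k r s + of_bool (k = boundary_degree p q + 1)"
proof -
  have "pivoted p q (p + r) (q + s) \<and> pivoted r s (p + r) (q + s) \<and>
    boundary_degree (p + r) (q + s) = boundary_degree r s + 1 \<and>
    inner_count k (p + r) (q + s) =
      inner_count k p q + inner_count k r s + of_bool (k = boundary_degree p q + 1)"
    (is ?goal)
    using assms[unfolded pivoted_def]
  proof (elim disjE conjE)
    assume n: "farey_neighbours p q r s" and f: "first_degree r s = first_degree p q + 1"
    show ?goal
      using farey_neighbours_mediant[OF n] first_degree_mediant[OF n] last_degree_mediant[OF n]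
        inner_count_mediant[OF n, of k] f
      by (auto simp: pivoted_def boundary_degree_def)
  next
    assume n: "farey_neighbours r s p q" and l: "last_degree r s = last_degree p q + 1"
    show ?goal
      using farey_neighbours_mediant[OF n] first_degree_mediant[OF n] last_degree_mediant[OF n]
        inner_count_mediant[OF n, of k] l
      by (auto simp: pivoted_def boundary_degree_def add.commute)
  qed
  then show "pivoted p q (p + r) (q + s)" "pivoted r s (p + r) (q + s)"
    and "boundary_degree (p + r) (q + s) = boundary_degree r s + 1"
    and "inner_count k (p + r) (q + s) =
           inner_count k p q + inner_count k r s + of_bool (k = boundary_degree p q + 1)"
    by auto
qed

text \<open>
  The descent from \<open>(P, O)\<close> to \<open>m P + n O\<close> is the subtractive Euclidean algorithm on \<open>(m, n)\<close>.  Each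
  seam made with pivot \<open>P\<close> has degree \<open>t(P) + 1\<close>, and all seams after the first turn have degree
  above \<open>t(O)\<close>, hence different from \<open>k\<close>.  So when \<open>k = t(P) + 1\<close>, every copy of \<open>P\<close> that is
  attached brings one seam along, as if \<open>P\<close> had one more inner node of degree \<open>k\<close>.  At the
  end \<open>P\<close> itself (\<open>m = 1\<close>, \<open>n = 0\<close>) this correction would be wrong, whence the positivity of \<open>n\<close>.
\<close>

lemma inner_count_linear:
  assumes "pivoted p q r s" "k \<le> boundary_degree r s" "0 < m" "0 < n" "coprime m n"
  shows "inner_count k (m * p + n * r) (m * q + n * s) =
    m * (inner_count k p q + of_bool (k = boundary_degree p q + 1)) + n * inner_count k r s"
  using assms
proof (induction "m + n" arbitrary: m n p q r s rule: less_induct)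
  case less
  note piv = pivoted_mediant[OF less.prems(1)]
  consider "m = n" | "n < m" | "m < n" by linarith
  then show ?case
  proof cases
    \<comment> \<open>By coprimality this is the mediant itself.\<close>
    case 1
    with less.prems(5) have "m = 1" "n = 1" by simp_all
    then show ?thesis using piv(4)[of k] by simp
  next
    \<comment> \<open>The pivot is kept: \<open>m P + n O = (m - n) P + n M\<close>.\<close>
    case 2
    then obtain j where j: "m = j + n" "0 < j" by (metis add.commute less_imp_add_positive)
    have "coprime j n"
      using less.prems(5) unfolding j(1) by (simp only: coprime_iff_gcd_eq_1 gcd_add1)
    then show ?thesis
      using less.hyps[of j n p q "p + r" "q + s"] less.prems piv(1,3) piv(4)[of k] j
      by (simp add: algebra_simps)
  next
    \<comment> \<open>The turn: \<open>m P + n O = (n - m) O + m M\<close> with the pivot \<open>O\<close>, whose seam degree \<open>t(O) + 1\<close>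
      exceeds \<open>k\<close>.\<close>
    case 3
    then obtain j where j: "n = j + m" "0 < j" by (metis add.commute less_imp_add_positive)
    have "coprime j m"
      using less.prems(5) unfolding j(1) by (simp only: coprime_iff_gcd_eq_1 gcd.commute[of m] gcd_add1)
    then show ?thesis
      using less.hyps[of j m r s "p + r" "q + s"] less.prems piv(2,3) piv(4)[of k] j
      by (simp add: algebra_simps)
  qed
qed

text \<open>
  The matrix with the columns \<open>(a, b)\<close> and \<open>(c, d)\<close> has determinant \<open>-1\<close>, so the coordinates of \<open>(p, q)\<close>
  are integers and have no more common divisors than \<open>p\<close> and \<open>q\<close>; they are positive because \<open>p / q\<close>
  lies in between.
\<close>

lemma coprime_combination:
  assumes n: "farey_neighbours a b c d" and cop: "coprime p q" "0 < q"
    and "real a / real b < real p / real q" "real p / real q < real c / real d"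
  obtains m n where "0 < m" "0 < n" "coprime m n" "p = m * a + n * c" "q = m * b + n * d"
proof -
  have bd: "0 < b" "0 < d" "b * c = a * d + 1" using n by (auto simp: farey_neighbours_def)
  have "real (a * q) < real (b * p)" "real (d * p) < real (c * q)"
    using assms(3-5) bd by (simp_all add: field_simps)
  then have lt: "a * q < b * p" "d * p < c * q" by (simp_all only: of_nat_less_iff)
  define m where "m = c * q - d * p"
  define n where "n = b * p - a * q"
  have mn: "int m = int c * int q - int d * int p" "int n = int b * int p - int a * int q"
    using lt by (simp_all add: m_def n_def of_nat_diff)
  have det: "int b * int c = int a * int d + 1"
    using bd(3) by (metis of_nat_1 of_nat_add of_nat_mult)
  have "int m * int a + int n * int c = int p * (int b * int c - int a * int d)"
       "int m * int b + int n * int d = int q * (int b * int c - int a * int d)"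
    unfolding mn by (simp_all add: algebra_simps)
  then have "int (m * a + n * c) = int p" "int (m * b + n * d) = int q"
    using det by simp_all
  then have pq: "p = m * a + n * c" "q = m * b + n * d"
    by (simp_all only: of_nat_eq_iff)
  have "coprime m n"
  proof (rule coprimeI)
    fix e assume "e dvd m" "e dvd n"
    then have "e dvd p" "e dvd q" unfolding pq by simp_all
    then show "is_unit e" using cop(1) coprime_common_divisor by blast
  qed
  moreover have "0 < m" "0 < n" using lt by (simp_all add: m_def n_def)
  ultimately show thesis using pq that by blast
qed

definition linear_between :: "nat \<Rightarrow> real \<Rightarrow> real \<Rightarrow> bool" where
  "linear_between k u v \<longleftrightarrow> (\<exists>\<alpha> \<beta>. \<forall>p q. coprime p q \<longrightarrow> 0 < q \<longrightarrow>
     u < real p / real q \<longrightarrow> real p / real q < v \<longrightarrow>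
     real (inner_count k p q) = \<alpha> * real p + \<beta> * real q)"

lemma linear_betweenI:
  assumes n: "farey_neighbours a b c d"
    and lin: "\<And>m n. \<lbrakk>0 < m; 0 < n; coprime m n\<rbrakk> \<Longrightarrow>
      inner_count k (m * a + n * c) (m * b + n * d) = m * x + n * y"
  shows "linear_between k (real a / real b) (real c / real d)"
  unfolding linear_between_def
proof (intro exI allI impI)
  fix p q :: nat
  assume "coprime p q" "0 < q" "real a / real b < real p / real q" "real p / real q < real c / real d"
  then obtain m n where mn: "0 < m" "0 < n" "coprime m n" "p = m * a + n * c" "q = m * b + n * d"
    using coprime_combination[OF n] by metis
  have "b * c = a * d + 1" using n by (simp add: farey_neighbours_def)
  then have det: "real b * real c = real a * real d + 1"
    by (metis of_nat_1 of_nat_add of_nat_mult)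
  \<comment> \<open>The linear form with the value \<open>x\<close> at \<open>(a, b)\<close> and \<open>y\<close> at \<open>(c, d)\<close>, by Cramer's rule.\<close>
  have "(real y * real b - real x * real d) * real p + (real x * real c - real y * real a) * real q
      = (real m * real x + real n * real y) * (real b * real c - real a * real d)"
    unfolding mn by (simp add: algebra_simps)
  also have "\<dots> = real (inner_count k p q)"
    using det lin[OF mn(1-3)] mn(4,5) by simp
  finally show "real (inner_count k p q) =
      (real y * real b - real x * real d) * real p + (real x * real c - real y * real a) * real q"
    by simp
qed

lemma pivoted_linear_between:
  assumes "pivoted p q r s" "k \<le> boundary_degree r s"
  shows "linear_between k (min (real p / real q) (real r / real s))
    (max (real p / real q) (real r / real s))"
proof -
  have less: "real a / real b < real c / real d" if "farey_neighbours a b c d" for a b c d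
  proof -
    have "real (a * d) < real (c * b)"
      using that by (subst of_nat_less_iff) (simp add: farey_neighbours_def mult.commute)
    then show ?thesis using that by (simp add: farey_neighbours_def field_simps)
  qed
  note lin = inner_count_linear[OF assms]
  show ?thesis
    using assms(1) unfolding pivoted_def
  proof (elim disjE conjE)
    assume n: "farey_neighbours p q r s"
    from linear_betweenI[OF n lin] less[OF n] show ?thesis by (simp add: min_def max_def)
  next
    assume n: "farey_neighbours r s p q"
    have "linear_between k (real r / real s) (real p / real q)"
    proof (rule linear_betweenI[OF n])
      fix m n :: nat assume "0 < m" "0 < n" "coprime m n"
      then show "inner_count k (m * r + n * p) (m * s + n * q) =
          m * inner_count k r s + n * (inner_count k p q + of_bool (k = boundary_degree p q + 1))"
        using lin[of n m] by (simp only: add.commute coprime_commute)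
    qed
    with less[OF n] show ?thesis by (simp add: min_def max_def)
  qed
qed

section \<open>Convergents of an irrational number\<close>

context
  fixes x :: real
  assumes irrational: "x \<notin> \<rat>" and pos: "0 < x"
begin

lemma complete_quotient_irrational: "complete_quotient x n \<notin> \<rat>"
proof (induction n)
  case (Suc n)
  show ?case
  proof
    assume "complete_quotient x (Suc n) \<in> \<rat>"
    then have "inverse (1 / frac (complete_quotient x n)) \<in> \<rat>" by (simp only: complete_quotient.simps Rats_inverse)
    then have "frac (complete_quotient x n) + of_int \<lfloor>complete_quotient x n\<rfloor> \<in> \<rat>"
      by (intro Rats_add) auto
    then show False using Suc by (simp add: frac_def)
  qed
qed (simp add: irrational)

lemma frac_complete_quotient_pos: "0 < frac (complete_quotient x n)"
  using complete_quotient_irrational[of n] Ints_subset_Rats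
  by (auto simp: frac_gt_0_iff)

lemma complete_quotient_gt_1: "1 < complete_quotient x (Suc n)"
  using frac_complete_quotient_pos[of n] frac_lt_1[of "complete_quotient x n"] by simp

lemma complete_quotient_step:
  "complete_quotient x n = real (partial_quotient x n) + 1 / complete_quotient x (Suc n)"
proof -
  have "0 \<le> complete_quotient x n"
    using pos complete_quotient_gt_1 by (cases n) (auto intro: less_imp_le order.strict_trans[of 0 1])
  then show ?thesis by (simp add: partial_quotient_def frac_def)
qed

lemma partial_quotient_pos: "1 \<le> partial_quotient x (Suc n)"
  using complete_quotient_gt_1[of n] unfolding partial_quotient_def by linarith

lemma convergent_den_pos: "0 < convergent_den x n"
proof (induction n rule: induct_nat_012)
  case (ge2 n)
  then show ?case by simp
qed (use partial_quotient_pos[of 0] in auto)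

lemma convergent_den_ge: "n \<le> convergent_den x n"
proof (induction n rule: induct_nat_012)
  case (ge2 n)
  have "1 * convergent_den x (Suc n) \<le> partial_quotient x (Suc (Suc n)) * convergent_den x (Suc n)"
    by (intro mult_le_mono1 partial_quotient_pos)
  then show ?case using ge2 convergent_den_pos[of n] unfolding convergent_den.simps by linarith
qed (use partial_quotient_pos[of 0] in auto)

text \<open>
  The recurrence of the convergents multiplies their matrix by one of determinant \<open>-1\<close>.
\<close>

lemma convergent_det:
  "int (convergent_num x (Suc n)) * int (convergent_den x n)
     - int (convergent_num x n) * int (convergent_den x (Suc n)) = (-1) ^ n"
  by (induction n) (simp_all add: algebra_simps)

lemma coprime_convergent: "coprime (convergent_num x n) (convergent_den x n)"
proof (rule coprimeI)
  fix e assume "e dvd convergent_num x n" "e dvd convergent_den x n"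
  then have "int e dvd int (convergent_num x (Suc n)) * int (convergent_den x n)
     - int (convergent_num x n) * int (convergent_den x (Suc n))"
    by (intro dvd_diff dvd_mult dvd_mult2) simp_all
  then have "int e dvd (-1) ^ n" by (simp only: convergent_det)
  then show "is_unit e" by (simp add: minus_one_power_iff split: if_splits)
qed

text \<open>
  The number \<open>x\<close> is what results from its continued fraction when the tail is replaced by a complete
  quotient.
\<close>

lemma convergent_identity:
  "x * (complete_quotient x (Suc (Suc n)) * convergent_den x (Suc n) + convergent_den x n)
     = complete_quotient x (Suc (Suc n)) * convergent_num x (Suc n) + convergent_num x n"
proof (induction n)
  case 0
  define c d where "c = complete_quotient x (Suc 0)" and "d = complete_quotient x (Suc (Suc 0))"
  have "x = real (partial_quotient x 0) + 1 / c"
    using complete_quotient_step[of 0] by (simp add: c_def)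
  moreover have "0 < c" "0 < d"
    using complete_quotient_gt_1[of 0] complete_quotient_gt_1[of "Suc 0"] by (simp_all add: c_def d_def del: complete_quotient.simps)
  ultimately have "x * c = partial_quotient x 0 * c + 1"
    by (metis distrib_right nonzero_eq_divide_eq order_less_irrefl)
  moreover have "c = real (partial_quotient x (Suc 0)) + 1 / d"
    unfolding c_def d_def by (rule complete_quotient_step)
  with \<open>0 < d\<close> have "c * d = partial_quotient x (Suc 0) * d + 1"
    by (simp add: distrib_right)
  ultimately have "x * (d * partial_quotient x (Suc 0) + 1) =
      d * (real (partial_quotient x (Suc 0)) * real (partial_quotient x 0) + 1) + partial_quotient x 0"
    by algebra
  then show ?case by (simp add: d_def del: complete_quotient.simps)
next
  case (Suc n)
  define c where "c = complete_quotient x (Suc (Suc (Suc n)))"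
  have c: "0 < c" using complete_quotient_gt_1[of "Suc (Suc n)"] by (simp add: c_def del: complete_quotient.simps)
  have step: "complete_quotient x (Suc (Suc n)) = real (partial_quotient x (Suc (Suc n))) + 1 / c"
    unfolding c_def by (rule complete_quotient_step)
  have "x * ((partial_quotient x (Suc (Suc n)) * c + 1) * convergent_den x (Suc n) + c * convergent_den x n)
     = (partial_quotient x (Suc (Suc n)) * c + 1) * convergent_num x (Suc n) + c * convergent_num x n"
    using arg_cong[OF Suc[unfolded step], of "\<lambda>y. c * y"] c
    by (simp add: algebra_simps del: complete_quotient.simps)
  then show ?case unfolding c_def[symmetric] by (simp add: algebra_simps del: complete_quotient.simps)
qed

text \<open>
  The identity above and the determinant give \<open>(x q - p) z = \<plusminus>1\<close>, where \<open>z\<close> is at least \<open>1\<close>.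
\<close>

lemma convergent_error: "\<bar>x - convergent_num x (Suc n) / convergent_den x (Suc n)\<bar> \<le> 1 / convergent_den x (Suc n)"
proof -
  let ?p = "real (convergent_num x (Suc n))" and ?q = "real (convergent_den x (Suc n))"
  define z where "z = complete_quotient x (Suc (Suc n)) * ?q + convergent_den x n"
  have q: "1 \<le> ?q" using convergent_den_pos[of "Suc n"] by linarith
  then have "1 * 1 \<le> complete_quotient x (Suc (Suc n)) * ?q"
    using complete_quotient_gt_1[of "Suc n"] by (intro mult_mono) auto
  then have z: "1 \<le> z" by (simp add: z_def add_increasing2)
  have "(x * ?q - ?p) * z = real (convergent_num x n) * ?q - ?p * convergent_den x n"
    using convergent_identity[of n] unfolding z_def by algebra
  also have "\<dots> = - of_int ((-1) ^ n)"
    unfolding convergent_det[symmetric] by simp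
  finally have "\<bar>(x * ?q - ?p) * z\<bar> = 1" by (simp add: power_abs)
  then have "\<bar>x * ?q - ?p\<bar> * z = 1"
    using z by (simp add: abs_mult)
  then have "\<bar>x * ?q - ?p\<bar> \<le> 1"
    using z by (metis abs_ge_zero mult_left_mono mult.right_neutral)
  moreover have "x - ?p / ?q = (x * ?q - ?p) / ?q" using q by (simp add: field_simps)
  ultimately show ?thesis using q by (simp add: abs_divide divide_right_mono)
qed

lemma convergent_den_at_top: "filterlim (\<lambda>n. real (convergent_den x n)) at_top sequentially"
  by (rule filterlim_at_top_mono[OF filterlim_real_sequentially]) (simp add: convergent_den_ge)

lemma inverse_convergent_den: "(\<lambda>n. 1 / real (convergent_den x n)) \<longlonglongrightarrow> 0"
  by (rule tendsto_divide_0[OF tendsto_const filterlim_at_top_imp_at_infinity[OF convergent_den_at_top]])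

lemma convergents_converge: "(\<lambda>n. real (convergent_num x n) / real (convergent_den x n)) \<longlonglongrightarrow> x"
proof -
  have "(\<lambda>n. real (convergent_num x (Suc n)) / real (convergent_den x (Suc n)) - x) \<longlonglongrightarrow> 0"
    by (rule Lim_null_comparison[OF _ LIMSEQ_Suc[OF inverse_convergent_den]])
       (use convergent_error in \<open>simp add: abs_minus_commute\<close>)
  then have "(\<lambda>n. real (convergent_num x (Suc n)) / real (convergent_den x (Suc n))) \<longlonglongrightarrow> x"
    by (simp only: LIM_zero_iff)
  then show ?thesis by (rule LIMSEQ_imp_Suc)
qed

end

text \<open>
  Convergents of \<open>x\<close> are eventually strictly between \<open>u\<close> and \<open>v\<close>, where the proportion of nodes of
  degree \<open>k\<close> is \<open>\<alpha> p / q + \<beta>\<close>, up to the contribution of the boundary node.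
\<close>

lemma degree_dist_affine:
  assumes lin: "linear_between k u v" and uv: "0 \<le> u" "v \<le> 1"
  obtains a b where "\<And>x. \<lbrakk>x \<notin> \<rat>; u < x; x < v\<rbrakk> \<Longrightarrow> degree_dist k x = a * x + b"
proof -
  obtain \<alpha> \<beta> where ab: "\<And>p q. \<lbrakk>coprime p q; 0 < q; u < real p / real q; real p / real q < v\<rbrakk> \<Longrightarrow>
     real (inner_count k p q) = \<alpha> * real p + \<beta> * real q"
    using lin unfolding linear_between_def by blast
  have "degree_dist k x = \<alpha> * x + \<beta>" if x: "x \<notin> \<rat>" "u < x" "x < v" for x
  proof -
    have x0: "0 < x" using x uv by linarith
    let ?p = "convergent_num x" and ?q = "convergent_den x"
    note conv = convergents_converge[OF x(1) x0]
    have "((\<lambda>n. \<alpha> * (?p n / ?q n) + \<beta>) \<longlongrightarrow> \<alpha> * x + \<beta>) sequentially"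
      by (intro tendsto_intros conv)
    moreover have "((\<lambda>n. of_bool (boundary_degree (?p n) (?q n) = k) / real (?q n)) \<longlongrightarrow> 0) sequentially"
      by (rule Lim_null_comparison[OF _ inverse_convergent_den[OF x(1) x0]]) auto
    ultimately have "((\<lambda>n. \<alpha> * (?p n / ?q n) + \<beta> + of_bool (boundary_degree (?p n) (?q n) = k) / real (?q n))
        \<longlongrightarrow> \<alpha> * x + \<beta> + 0) sequentially"
      by (rule tendsto_add)
    moreover have "\<forall>\<^sub>F n in sequentially. \<alpha> * (?p n / ?q n) + \<beta> + of_bool (boundary_degree (?p n) (?q n) = k) / real (?q n)
        = frac_degree_dist k (?p n) (?q n)"
      using order_tendstoD(1)[OF conv x(2)] order_tendstoD(2)[OF conv x(3)]
    proof eventually_elim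
      case (elim n)
      have q: "0 < ?q n" by (rule convergent_den_pos[OF x(1) x0])
      have cop: "coprime (?p n) (?q n)" by (rule coprime_convergent[OF x(1) x0])
      have "real (?p n) / real (?q n) \<le> 1" using elim uv by linarith
      then have le: "?p n \<le> ?q n" using q by (simp add: field_simps)
      show ?case
        unfolding frac_degree_dist_eq[OF cop q le] ab[OF cop q elim]
        using q by (simp add: field_simps)
    qed
    ultimately have "(\<lambda>n. frac_degree_dist k (?p n) (?q n)) \<longlonglongrightarrow> \<alpha> * x + \<beta>"
      using Lim_transform_eventually by fastforce
    then show ?thesis using x(1) by (simp add: degree_dist_def limI)
  qed
  then show thesis using that by blast
qed

section \<open>Assembling the pieces\<close>

text \<open>
  The endpoints are rational so that an irrational number of the interval is an interior point.
\<close>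

definition affine_piece :: "(real \<Rightarrow> real) \<Rightarrow> real set \<Rightarrow> bool" where
  "affine_piece f I \<longleftrightarrow> (\<exists>s\<in>\<rat>. \<exists>t\<in>\<rat>. I = {s..t}) \<and> (\<exists>a b. \<forall>x\<in>I - \<rat>. f x = a * x + b)"

definition piecewise_affine :: "(real \<Rightarrow> real) \<Rightarrow> real \<Rightarrow> real \<Rightarrow> bool" where
  "piecewise_affine f u v \<longleftrightarrow> (\<exists>D. D division_of {u..v} \<and> (\<forall>I\<in>D. affine_piece f I))"

lemma piecewise_affine_join:
  assumes "piecewise_affine f u w" "piecewise_affine f w v" "u \<le> w" "w \<le> v"
  shows "piecewise_affine f u v"
proof -
  obtain D where D: "D division_of {u..w}" "\<forall>I\<in>D. affine_piece f I"
    using assms(1) unfolding piecewise_affine_def by blast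
  obtain E where E: "E division_of {w..v}" "\<forall>I\<in>E. affine_piece f I"
    using assms(2) unfolding piecewise_affine_def by blast
  have "interior {u..w} \<inter> interior {w..v} = {}"
    by auto
  from division_disjoint_union[OF D(1) E(1) this] have "D \<union> E division_of {u..v}"
    by (simp only: ivl_disj_un_two_touch(4)[OF assms(3,4)])
  with D(2) E(2) show ?thesis
    unfolding piecewise_affine_def by (intro exI[of _ "D \<union> E"]) (simp add: ball_Un)
qed

text \<open>
  The pivot may be the left or the right endpoint, so intervals are given by their two endpoints in
  either order.
\<close>

lemma piecewise_affine_join_min_max:
  assumes "piecewise_affine f (min u w) (max u w)" "piecewise_affine f (min v w) (max v w)"
    and "u \<le> w \<and> w \<le> v \<or> v \<le> w \<and> w \<le> u"
  shows "piecewise_affine f (min u v) (max u v)"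
  using assms(3)
proof (elim disjE conjE)
  assume le: "u \<le> w" "w \<le> v"
  have "piecewise_affine f u w" "piecewise_affine f w v"
    using assms(1,2) by (simp_all only: min_absorb1[OF le(1)] max_absorb2[OF le(1)]
        min_absorb2[OF le(2)] max_absorb1[OF le(2)])
  from piecewise_affine_join[OF this le] show ?thesis
    by (simp only: min_absorb1[OF order.trans[OF le]] max_absorb2[OF order.trans[OF le]])
next
  assume le: "v \<le> w" "w \<le> u"
  have "piecewise_affine f v w" "piecewise_affine f w u"
    using assms(1,2) by (simp_all only: min_absorb1[OF le(1)] max_absorb2[OF le(1)]
        min_absorb2[OF le(2)] max_absorb1[OF le(2)])
  from piecewise_affine_join[OF this le] show ?thesis
    by (simp only: min_absorb2[OF order.trans[OF le]] max_absorb1[OF order.trans[OF le]])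
qed

text \<open>
  Splitting at the mediant makes \<open>p / q\<close> and \<open>r / s\<close> the pivots of the two halves, with the mediant as
  the second fraction in both.  Its boundary degree is larger by one than that of \<open>r / s\<close>, so the
  measure \<open>k - boundary_degree r s\<close> decreases.
\<close>

lemma piecewise_affine_pivoted:
  assumes "pivoted p q r s"
  shows "piecewise_affine (degree_dist k) (min (real p / real q) (real r / real s))
    (max (real p / real q) (real r / real s))"
  using assms
proof (induction "k - boundary_degree r s" arbitrary: p q r s rule: less_induct)
  case less
  let ?u = "real p / real q" and ?v = "real r / real s"
  show ?case
  proof (cases "k \<le> boundary_degree r s")
    case True
    have pqrs: "p \<le> q" "r \<le> s"
      using less.prems farey_neighbours_haros(1,2)[THEN haros_graph_reduced(3)]
      unfolding pivoted_def by blast+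
    then have "0 \<le> min ?u ?v" "max ?u ?v \<le> 1" by (auto simp: divide_le_eq_1)
    then obtain a b where ab: "\<And>x. \<lbrakk>x \<notin> \<rat>; min ?u ?v < x; x < max ?u ?v\<rbrakk> \<Longrightarrow> degree_dist k x = a * x + b"
      using degree_dist_affine[OF pivoted_linear_between[OF less.prems True]] by metis
    define lo hi where "lo = min ?u ?v" and "hi = max ?u ?v"
    have rat: "lo \<in> \<rat>" "hi \<in> \<rat>" and "lo \<le> hi"
      by (auto simp: lo_def hi_def min_def max_def)
    have "degree_dist k x = a * x + b" if x: "x \<in> {lo..hi} - \<rat>" for x
    proof -
      have "x \<noteq> lo" "x \<noteq> hi" using x rat by blast+
      then show ?thesis using x ab[of x] by (simp add: lo_def[symmetric] hi_def[symmetric])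
    qed
    moreover have "{{lo..hi}} division_of {lo..hi}"
      using division_of_self[of lo hi] \<open>lo \<le> hi\<close> by simp
    moreover from calculation have "affine_piece (degree_dist k) {lo..hi}"
      unfolding affine_piece_def using rat by blast
    ultimately have "piecewise_affine (degree_dist k) lo hi"
      unfolding piecewise_affine_def by (intro exI[of _ "{{lo..hi}}"]) simp
    then show ?thesis by (simp only: lo_def hi_def)
  next
    case False
    let ?w = "real (p + r) / real (q + s)"
    note piv = pivoted_mediant[OF less.prems]
    have "k - boundary_degree (p + r) (q + s) < k - boundary_degree r s"
      using False piv(3) by linarith
    then have 1: "piecewise_affine (degree_dist k) (min ?u ?w) (max ?u ?w)"
      and 2: "piecewise_affine (degree_dist k) (min ?v ?w) (max ?v ?w)"
      using less.hyps[OF _ piv(1)] less.hyps[OF _ piv(2)] by blast+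
    have qs: "0 < q" "0 < s" using less.prems unfolding pivoted_def farey_neighbours_def by blast+
    have "?u \<le> ?w \<and> ?w \<le> ?v \<or> ?v \<le> ?w \<and> ?w \<le> ?u"
      by (cases "?u \<le> ?v") (use qs in \<open>simp_all add: field_simps\<close>)
    then show ?thesis by (rule piecewise_affine_join_min_max[OF 1 2])
  qed
qed

text \<open>
  The pair \<open>0/1\<close>, \<open>1/1\<close> has no pivot, as all four extreme degrees are \<open>1\<close>.  After one splitting, at
  \<open>1/2\<close>, the two outer fractions are pivots.
\<close>

lemma piecewise_affine_degree_dist: "piecewise_affine (degree_dist k) 0 1"
proof -
  have n: "farey_neighbours 0 1 1 1" by (simp add: farey_neighbours_def)
  note m = farey_neighbours_mediant[OF n] first_degree_mediant[OF n] last_degree_mediant[OF n]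
  have "pivoted 0 1 (0 + 1) (1 + 1)"
    unfolding pivoted_def by (rule disjI1[OF conjI[OF m(1,3)]])
  moreover have "pivoted 1 1 (0 + 1) (1 + 1)"
    unfolding pivoted_def by (rule disjI2[OF conjI[OF m(2,4)]])
  ultimately have "piecewise_affine (degree_dist k) 0 (1 / 2)" "piecewise_affine (degree_dist k) (1 / 2) 1"
    using piecewise_affine_pivoted[of 0 1 "0 + 1" "1 + 1" k]
      piecewise_affine_pivoted[of 1 1 "0 + 1" "1 + 1" k]
    by simp_all
  then show ?thesis by (rule piecewise_affine_join) simp_all
qed

lemma piecewise_affine_continuous:
  fixes f :: "real \<Rightarrow> real"
  assumes "D division_of S"
    and D: "\<And>I. I \<in> D \<Longrightarrow> affine_piece f I"
  shows "continuous_on (S - \<rat>) f"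
  unfolding continuous_on_def
proof
  fix x assume x: "x \<in> S - \<rat>"
  then obtain I where I: "I \<in> D" "x \<in> I" using assms(1) by (auto simp: division_of_def)
  obtain s t a b where st: "s \<in> \<rat>" "t \<in> \<rat>" "I = {s..t}" and ab: "\<And>x. x \<in> I - \<rat> \<Longrightarrow> f x = a * x + b"
    using D[OF I(1)] unfolding affine_piece_def by blast
  have "x \<in> {s<..<t}" using st I(2) x by (auto simp: order.strict_iff_order)
  then have "\<forall>\<^sub>F y in at x within S - \<rat>. a * y + b = f y"
    unfolding eventually_at_topological
    by (intro exI[of _ "{s<..<t}"]) (auto simp: ab st(3))
  moreover have "((\<lambda>y. a * y + b) \<longlongrightarrow> f x) (at x within S - \<rat>)"
    using ab[of x] I(2) x by (auto intro!: tendsto_eq_intros)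
  ultimately show "(f \<longlongrightarrow> f x) (at x within S - \<rat>)"
    by (rule Lim_transform_eventually[rotated])
qed

theorem corollary3:
  fixes k :: nat
  shows "\<exists>N \<subseteq> {0..1::real}. N \<in> null_sets lebesgue \<and>
           continuous_on ({0..1} - N) (degree_dist k) \<and>
           (\<exists>D. D division_of {0..1::real} \<and>
              (\<forall>I\<in>D. \<exists>a b. \<forall>x\<in>I - N. degree_dist k x = a * x + b))"
proof -
  obtain D where D: "D division_of {0..1::real}"
    "\<And>I. I \<in> D \<Longrightarrow> affine_piece (degree_dist k) I"
    using piecewise_affine_degree_dist[of k] unfolding piecewise_affine_def by blast
  define N where "N = {0..1::real} \<inter> \<rat>"
  have "N \<in> null_sets lebesgue"
    unfolding N_def by (intro countable_imp_null_set_lborel[THEN null_sets_completionI] countable_Int2) (simp add: countable_rat)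
  moreover have "continuous_on ({0..1} - N) (degree_dist k)"
    using piecewise_affine_continuous[OF D] by (simp add: N_def Diff_Int)
  moreover have "\<forall>I\<in>D. \<exists>a b. \<forall>x\<in>I - N. degree_dist k x = a * x + b"
  proof
    fix I assume I: "I \<in> D"
    have "I - N = I - \<rat>"
      using division_ofD(2)[OF D(1) I] by (auto simp: N_def)
    with D(2)[OF I] show "\<exists>a b. \<forall>x\<in>I - N. degree_dist k x = a * x + b"
      by (simp add: affine_piece_def)
  qed
  moreover have "N \<subseteq> {0..1}" by (simp add: N_def)
  ultimately show ?thesis using D(1) by blast
qed

end
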